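(* Let $n$ be a natural number, $N=2^{n+2}-n-4$, and let $\gamma$ (possibly depending on $n$) satisfy $0<\gamma<\frac12$. Then $$\widetilde{\deg}_{\frac12-\gamma}(\mathsf{AHS}_N) = \Omega\left(\frac{n}{\log n} - \log\frac{1}{\gamma}\right).$$
   Context: For a partial Boolean function $f:D\to\{0,1\}$ with $D\subseteq\{0,1\}^N$ and $0<\varepsilon<\frac12$, a real polynomial $p:\{0,1\}^N\to\mathbb{R}$ is an $\varepsilon$-approximation to $f$ if $|p(y)-f(y)|\le\varepsilon$ for every $y\in D$ and $-\varepsilon\le p(y)\le1+\varepsilon$ for every $y\in\{0,1\}^N$; $\widetilde{\deg}_\varepsilon(f)$ is the least degree of such a polynomial. Let $\{0,1\}^{\le k}=\bigcup_{j=0}^k\{0,1\}^j$ and $[n]=\{1,\dots,n\}$. For $i\in[n]$, $s\in\{0,1\}^{\le n-i+1}$ and $x\in\{0,1\}^n$, let $\phi_{i,s}(x)=1$ if $x_{i+k-1}=s_k$ for all $1\le k\le|s|$, and $\phi_{i,s}(x)=0$ otherwise. The anchored hidden string function $\mathsf{AHS}_N$ is the partial function on $\{0,1\}^N$, with coordinates indexed by the $N=2^{n+2}-n-4$ pairs $(i,s)$ with $i\in[n]$, $s\in\{0,1\}^{\le n-i+1}$, whose domain is $\{(\phi_{i,s}(x))_{(i,s)} : x\in\{0,1\}^n\}$ and which maps $(\phi_{i,s}(x))_{(i,s)}$ to $\mathsf{parity}(x)=x_1\oplus\cdots\oplus x_n$. Logarithms are base 2. *)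

theory Defs
  imports Complex_Main "HOL-Library.Poly_Mapping" "HOL-Library.FuncSet"
begin

section \<open>Real polynomials in finitely many variables\<close>

text \<open>A polynomial is the finitely supported map from its monomials (finitely supported
  exponent vectors) to its coefficients.\<close>

type_synonym 'v rpoly = "('v \<Rightarrow>\<^sub>0 nat) \<Rightarrow>\<^sub>0 real"

definition rpoly_eval :: "'v rpoly \<Rightarrow> ('v \<Rightarrow> real) \<Rightarrow> real" where
  "rpoly_eval p a =
     (\<Sum>m\<in>Poly_Mapping.keys p. Poly_Mapping.lookup p m *
       (\<Prod>v\<in>Poly_Mapping.keys m. a v ^ Poly_Mapping.lookup m v))"

definition rpoly_vars :: "'v rpoly \<Rightarrow> 'v set" where
  "rpoly_vars p = (\<Union>m\<in>Poly_Mapping.keys p. Poly_Mapping.keys m)"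

text \<open>The zero polynomial gets degree 0.\<close>

definition rpoly_degree :: "'v rpoly \<Rightarrow> nat" where
  "rpoly_degree p =
     Max (insert 0 ((\<lambda>m. \<Sum>v\<in>Poly_Mapping.keys m. Poly_Mapping.lookup m v) `
       Poly_Mapping.keys p))"

section \<open>Approximate degree of a partial Boolean function\<close>

text \<open>The Boolean cube with coordinates indexed by \<open>I\<close>; a partial Boolean function on it
  is a map \<open>f\<close> with \<open>dom f \<subseteq> cube I\<close>.\<close>

definition cube :: "'v set \<Rightarrow> ('v \<Rightarrow> bool) set" where
  "cube I = (I \<rightarrow>\<^sub>E UNIV)"

definition bool_eval :: "'v rpoly \<Rightarrow> ('v \<Rightarrow> bool) \<Rightarrow> real" where
  "bool_eval p y = rpoly_eval p (\<lambda>v. of_bool (y v))"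

definition approximates ::
    "'v set \<Rightarrow> real \<Rightarrow> 'v rpoly \<Rightarrow> (('v \<Rightarrow> bool) \<rightharpoonup> bool) \<Rightarrow> bool" where
  "approximates I \<epsilon> p f \<longleftrightarrow>
     rpoly_vars p \<subseteq> I \<and>
     (\<forall>y\<in>dom f. \<bar>bool_eval p y - of_bool (the (f y))\<bar> \<le> \<epsilon>) \<and>
     (\<forall>y\<in>cube I. - \<epsilon> \<le> bool_eval p y \<and> bool_eval p y \<le> 1 + \<epsilon>)"

definition approx_degree :: "'v set \<Rightarrow> real \<Rightarrow> (('v \<Rightarrow> bool) \<rightharpoonup> bool) \<Rightarrow> nat" where
  "approx_degree I \<epsilon> f = (LEAST d. \<exists>p. approximates I \<epsilon> p f \<and> rpoly_degree p = d)"

section \<open>The anchored hidden string function\<close>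

text \<open>An input \<open>x\<close> is a point of \<open>cube {1..n}\<close>. A string \<open>s\<close> is a list, so its \<open>k\<close>-th
  symbol, counted from 1, is \<open>s ! (k - 1)\<close>.\<close>

definition ahs_index :: "nat \<Rightarrow> (nat \<times> bool list) set" where
  "ahs_index n = {(i, s). i \<in> {1..n} \<and> length s \<le> n - i + 1}"

definition phi :: "nat \<Rightarrow> bool list \<Rightarrow> (nat \<Rightarrow> bool) \<Rightarrow> bool" where
  "phi i s x \<longleftrightarrow> (\<forall>k\<in>{1..length s}. x (i + k - 1) = s ! (k - 1))"

definition ahs_encode :: "nat \<Rightarrow> (nat \<Rightarrow> bool) \<Rightarrow> (nat \<times> bool list \<Rightarrow> bool)" where
  "ahs_encode n x = (\<lambda>(i, s)\<in>ahs_index n. phi i s x)"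

definition parity :: "nat \<Rightarrow> (nat \<Rightarrow> bool) \<Rightarrow> bool" where
  "parity n x \<longleftrightarrow> odd (card {j \<in> {1..n}. x j})"

definition AHS :: "nat \<Rightarrow> (nat \<times> bool list \<Rightarrow> bool) \<rightharpoonup> bool" where
  "AHS n y =
     (if y \<in> ahs_encode n ` cube {1..n}
      then Some (parity n (THE x. x \<in> cube {1..n} \<and> y = ahs_encode n x))
      else None)"

section \<open>The definitions are meaningful\<close>

lemma ahs_encode_inj: "inj_on (ahs_encode n) (cube {1..n})"
proof (rule inj_onI)
  fix x x' assume x: "x \<in> cube {1..n}" "x' \<in> cube {1..n}"
    and eq: "ahs_encode n x = ahs_encode n x'"
  show "x = x'"
  proof (rule PiE_ext)
    show "x \<in> {1..n} \<rightarrow>\<^sub>E UNIV" "x' \<in> {1..n} \<rightarrow>\<^sub>E UNIV"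
      using x by (simp_all add: cube_def)
    fix i assume "i \<in> {1..n}"
    then have "(i, [True]) \<in> ahs_index n" by (auto simp: ahs_index_def)
    then show "x i = x' i"
      using fun_cong[OF eq, of "(i, [True])"] by (simp add: ahs_encode_def phi_def)
  qed
qed

lemma dom_AHS: "dom (AHS n) = ahs_encode n ` cube {1..n}"
  by (auto simp: AHS_def dom_def)

lemma dom_AHS_subset: "dom (AHS n) \<subseteq> cube (ahs_index n)"
  unfolding dom_AHS by (auto simp: ahs_encode_def cube_def)

lemma AHS_encode:
  assumes "x \<in> cube {1..n}"
  shows "AHS n (ahs_encode n x) = Some (parity n x)"
proof -
  have "(THE x'. x' \<in> cube {1..n} \<and> ahs_encode n x = ahs_encode n x') = x"
    using assms inj_onD[OF ahs_encode_inj] by (intro the_equality) auto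
  then show ?thesis using assms by (auto simp: AHS_def)
qed

lemma finite_ahs_index: "finite (ahs_index n)"
proof (rule finite_subset)
  show "ahs_index n \<subseteq> {1..n} \<times> {s. set s \<subseteq> UNIV \<and> length s \<le> n + 1}"
    by (auto simp: ahs_index_def)
  show "finite ({1..n} \<times> {s :: bool list. set s \<subseteq> UNIV \<and> length s \<le> n + 1})"
    by (intro finite_cartesian_product finite_lists_length_le) auto
qed

lemma card_ahs_index: "card (ahs_index n) = 2 ^ (n + 2) - n - 4"
proof -
  have geo: "(\<Sum>j\<le>k. 2 ^ j) = 2 ^ (k + 1) - (1::nat)" for k
    by (induction k) auto
  have strings: "card {s :: bool list. length s \<le> k} = 2 ^ (k + 1) - 1" for k
    using card_lists_length_le[of "UNIV :: bool set" k] geo[of k] by simp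
  have fin: "finite {s :: bool list. length s \<le> k}" for k
    using finite_lists_length_le[of "UNIV :: bool set" k] by simp
  have "ahs_index n = (SIGMA i:{1..n}. {s. length s \<le> n - i + 1})"
    by (auto simp: ahs_index_def)
  then have "card (ahs_index n) = (\<Sum>i=1..n. 2 ^ (n - i + 2) - 1)"
    using fin by (simp add: strings)
  also have "\<dots> = (\<Sum>i=1..n. 2 ^ (i + 1) - 1)"
    by (rule sum.reindex_bij_witness[of _ "\<lambda>i. n + 1 - i" "\<lambda>i. n + 1 - i"])
       (auto simp: Suc_diff_le)
  also have "\<dots> = 2 ^ (n + 2) - n - 4"
  proof (induction n)
    case (Suc n)
    have "n + 4 \<le> 2 ^ (n + 2)" by (induction n) auto
    then show ?case using Suc by (simp add: algebra_simps)
  qed simp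
  finally show ?thesis .
qed

lemma rpoly_eval_add: "rpoly_eval (p + q) a = rpoly_eval p a + rpoly_eval q a"
  unfolding rpoly_eval_def
  by (rule setsum_keys_plus_distrib) (simp_all add: algebra_simps)

lemma rpoly_eval_sum: "rpoly_eval (sum p A) a = (\<Sum>i\<in>A. rpoly_eval (p i) a)"
  by (induction A rule: infinite_finite_induct)
     (simp_all add: rpoly_eval_add, simp_all add: rpoly_eval_def)

lemma rpoly_eval_single:
  "rpoly_eval (Poly_Mapping.single m c) a =
    c * (\<Prod>v\<in>Poly_Mapping.keys m. a v ^ Poly_Mapping.lookup m v)"
  by (simp add: rpoly_eval_def)

lemma multilinear_expansion:
  assumes "finite I"
  shows "\<exists>c. \<forall>y. (g :: ('v \<Rightarrow> bool) \<Rightarrow> real) (\<lambda>v. v \<in> I \<and> y v) =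
    (\<Sum>S\<in>Pow I. c S * (\<Prod>v\<in>S. of_bool (y v)))"
  using assms
proof (induction I arbitrary: g rule: finite_induct)
  case empty
  show ?case by (auto intro: exI[of _ "\<lambda>_. g (\<lambda>_. False)"])
next
  case (insert u I)
  obtain c0 where c0: "\<And>y. g (\<lambda>v. v \<in> I \<and> y v) =
      (\<Sum>S\<in>Pow I. c0 S * (\<Prod>v\<in>S. of_bool (y v)))"
    using insert.IH[of g] by blast
  obtain c1 where c1: "\<And>y. g (\<lambda>v. v = u \<or> v \<in> I \<and> y v) =
      (\<Sum>S\<in>Pow I. c1 S * (\<Prod>v\<in>S. of_bool (y v)))"
    using insert.IH[of "\<lambda>z. g (\<lambda>v. v = u \<or> z v)"] by blast
  define c where "c S = (if u \<in> S then c1 (S - {u}) - c0 (S - {u}) else c0 S)" for S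
  have "g (\<lambda>v. v \<in> insert u I \<and> y v) =
      (\<Sum>S\<in>Pow (insert u I). c S * (\<Prod>v\<in>S. of_bool (y v)))" for y
  proof -
    let ?m = "\<lambda>S. \<Prod>v\<in>S. of_bool (y v) :: real"
    have inj: "inj_on (insert u) (Pow I)"
      using insert.hyps by (auto simp: inj_on_def)
    have "(\<Sum>S\<in>Pow (insert u I). c S * ?m S) =
        (\<Sum>S\<in>Pow I. c S * ?m S) + (\<Sum>S\<in>insert u ` Pow I. c S * ?m S)"
      unfolding Pow_insert using insert.hyps by (intro sum.union_disjoint) auto
    also have "(\<Sum>S\<in>Pow I. c S * ?m S) = (\<Sum>S\<in>Pow I. c0 S * ?m S)"
      using insert.hyps by (intro sum.cong) (auto simp: c_def)
    also have "(\<Sum>S\<in>insert u ` Pow I. c S * ?m S) =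
        (\<Sum>S\<in>Pow I. (c1 S - c0 S) * (of_bool (y u) * ?m S))"
      unfolding sum.reindex[OF inj]
    proof (intro sum.cong refl)
      fix S assume "S \<in> Pow I"
      then have "u \<notin> S" "finite S" using insert.hyps by (auto intro: finite_subset)
      then show "((\<lambda>S. c S * ?m S) \<circ> insert u) S = (c1 S - c0 S) * (of_bool (y u) * ?m S)"
        by (simp add: c_def)
    qed
    finally have *: "(\<Sum>S\<in>Pow (insert u I). c S * ?m S) =
        (\<Sum>S\<in>Pow I. c0 S * ?m S) + (\<Sum>S\<in>Pow I. (c1 S - c0 S) * (of_bool (y u) * ?m S))" .
    show ?thesis
    proof (cases "y u")
      case True
      then have "(\<lambda>v. v \<in> insert u I \<and> y v) = (\<lambda>v. v = u \<or> v \<in> I \<and> y v)" by auto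
      then show ?thesis
        using True * c1[of y] by (simp add: sum.distrib[symmetric] algebra_simps)
    next
      case False
      then have "(\<lambda>v. v \<in> insert u I \<and> y v) = (\<lambda>v. v \<in> I \<and> y v)" by auto
      then show ?thesis using False * c0[of y] by simp
    qed
  qed
  then show ?case by blast
qed

lemma rpoly_interpolation:
  fixes g :: "('v \<Rightarrow> bool) \<Rightarrow> real"
  assumes "finite I"
  obtains p where "rpoly_vars p \<subseteq> I" "\<And>y. y \<in> cube I \<Longrightarrow> bool_eval p y = g y"
proof -
  define mon where "mon S = (\<Sum>v\<in>S. Poly_Mapping.single v (1::nat))" for S :: "'v set"
  have lookup_mon: "Poly_Mapping.lookup (mon S) v = of_bool (v \<in> S)" if "finite S" for S v
    using that by (simp add: mon_def lookup_sum lookup_single when_def of_bool_def)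
  have keys_mon: "Poly_Mapping.keys (mon S) = S" if "finite S" for S
    using lookup_mon[OF that] by (auto simp: in_keys_iff)
  define g' where "g' z = g (restrict z I)" for z
  obtain c where c: "\<And>y. g' (\<lambda>v. v \<in> I \<and> y v) =
      (\<Sum>S\<in>Pow I. c S * (\<Prod>v\<in>S. of_bool (y v)))"
    using multilinear_expansion[OF assms, of g'] by blast
  define p where "p = (\<Sum>S\<in>Pow I. Poly_Mapping.single (mon S) (c S))"
  show thesis
  proof (rule that[of p])
    have "Poly_Mapping.keys p \<subseteq> mon ` Pow I"
      using keys_sum[of "\<lambda>S. Poly_Mapping.single (mon S) (c S)" "Pow I"]
      by (fastforce simp: p_def split: if_splits)
    then have "rpoly_vars p \<subseteq> (\<Union>S\<in>Pow I. Poly_Mapping.keys (mon S))"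
      unfolding rpoly_vars_def by blast
    also have "\<dots> \<subseteq> I"
      using keys_mon finite_subset[OF _ assms] by auto
    finally show "rpoly_vars p \<subseteq> I" .
  next
    fix y assume "y \<in> cube I"
    then have "restrict (\<lambda>v. v \<in> I \<and> y v) I = y"
      by (auto simp: cube_def fun_eq_iff PiE_def extensional_def restrict_def)
    then have "g y = (\<Sum>S\<in>Pow I. c S * (\<Prod>v\<in>S. of_bool (y v)))"
      using c[of y] by (simp add: g'_def)
    also have "\<dots> = bool_eval p y"
      unfolding bool_eval_def p_def rpoly_eval_sum rpoly_eval_single
    proof (intro sum.cong refl)
      fix S assume "S \<in> Pow I"
      then have "finite S" using assms by (auto intro: finite_subset)
      then show "c S * (\<Prod>v\<in>S. of_bool (y v)) =
          c S * (\<Prod>v\<in>Poly_Mapping.keys (mon S). of_bool (y v) ^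
            Poly_Mapping.lookup (mon S) v)"
        by (simp add: keys_mon lookup_mon)
    qed
    finally show "bool_eval p y = g y" ..
  qed
qed

lemma approximates_exists:
  assumes "finite I" "dom f \<subseteq> cube I" "0 \<le> \<epsilon>"
  shows "\<exists>p. approximates I \<epsilon> p f"
proof -
  obtain p where p: "rpoly_vars p \<subseteq> I"
      "\<And>y. y \<in> cube I \<Longrightarrow> bool_eval p y = of_bool (f y = Some True)"
    using rpoly_interpolation[OF assms(1), of "\<lambda>y. of_bool (f y = Some True)"] by blast
  have "approximates I \<epsilon> p f"
    unfolding approximates_def using assms p by (auto simp: domI subset_iff)
  then show ?thesis ..
qed

text \<open>Hence the minimum in the approximate degree is attained.\<close>

lemma approx_degree_attained:
  assumes "finite I" "dom f \<subseteq> cube I" "0 \<le> \<epsilon>"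
  shows "\<exists>p. approximates I \<epsilon> p f \<and> rpoly_degree p = approx_degree I \<epsilon> f"
  unfolding approx_degree_def
  by (rule LeastI_ex) (use approximates_exists[OF assms] in blast)

end

theory Submission
  imports Defs "HOL-Computational_Algebra.Polynomial" "HOL-Analysis.Convex"
begin

text \<open>
  Write an approximating polynomial of degree \<open>d\<close> as a set function
  \<open>Y \<mapsto> (\<Sum>S \<subseteq> Y. c S)\<close> on sets \<open>Y\<close> of true coordinates. It is bounded on the whole cube, so
  averaging over random subsets of \<open>Y\<close> and bounding the coefficients of a bounded univariate
  polynomial shows that each homogeneous part is at most \<open>O(d)\<^sup>d\<close>; Parseval then bounds the
  sum of the \<open>c\<^sup>2\<close> at each level.

  On an encoding of \<open>x\<close>, the monomials that survive are indexed by sets \<open>T\<close> of at most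
  \<open>d\<close> windows of \<open>{1..n}\<close>, the strings being read off \<open>x\<close>. If \<open>T\<close> misses a position,
  flipping that bit shows that its contribution is uncorrelated with the parity. If \<open>T\<close> covers all
  positions, distinct \<open>x\<close> give distinct monomials, and by Cauchy-Schwarz the correlation is at most
  \<open>sqrt (2 ^ n)\<close> times the square root of the level sum. There are only \<open>n\<close> to the \<open>O(d)\<close>
  such \<open>T\<close>, while a correlation of at least \<open>\<gamma> * 2 ^ n\<close> is required.
\<close>

section \<open>Coefficients of a univariate polynomial bounded at separated points\<close>

text \<open>Synthetic division at the last point \<open>a\<close> leaves a quotient bounded by
  \<open>2 * B / \<delta>\<close> at the other points. Multiplying back by \<open>X - a\<close> with
  \<open>\<bar>a\<bar> \<le> 1\<close> at most doubles the bound on coefficients, and the remainder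
  adds at most \<open>B\<close>, so each point costs a factor
  \<open>1 + 4 / \<delta>\<close>.\<close>

lemma abs_coeff_le_of_separated_points:
  fixes q :: "real poly" and x :: "nat \<Rightarrow> real"
  assumes "degree q \<le> d" "\<delta> > 0"
    and "\<And>i. i \<le> d \<Longrightarrow> \<bar>x i\<bar> \<le> 1"
    and "\<And>i j. i < j \<Longrightarrow> j \<le> d \<Longrightarrow> \<delta> \<le> \<bar>x i - x j\<bar>"
    and "\<And>i. i \<le> d \<Longrightarrow> \<bar>poly q (x i)\<bar> \<le> B"
  shows "\<bar>coeff q k\<bar> \<le> (1 + 4 / \<delta>) ^ d * B"
  using assms
proof (induction d arbitrary: q B k)
  case 0
  then have "degree q = 0" by simp
  then obtain a where q: "q = [:a:]" by (rule degree_eq_zeroE)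
  then have "\<bar>a\<bar> \<le> B" using "0.prems"(5)[of 0] by simp
  moreover from this have "0 \<le> B" using abs_ge_zero[of a] by linarith
  ultimately show ?case by (simp add: q coeff_pCons split: nat.split)
next
  case (Suc d)
  define a where "a = x (Suc d)"
  define r where "r = synthetic_div q a"
  have q: "q = [:- a, 1:] * r + [:poly q a:]"
    unfolding r_def by (rule synthetic_div_correct'[symmetric])
  have B: "\<bar>poly q a\<bar> \<le> B" "0 \<le> B"
    using Suc.prems(5)[of "Suc d"] by (auto simp: a_def)
  have a: "\<bar>a\<bar> \<le> 1" using Suc.prems(3)[of "Suc d"] by (simp add: a_def)
  have r_at: "\<bar>poly r (x i)\<bar> \<le> 2 * B / \<delta>" if "i \<le> d" for i
  proof -
    have sep: "\<delta> \<le> \<bar>x i - a\<bar>" using Suc.prems(4)[of i "Suc d"] that by (simp add: a_def)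
    have "poly q (x i) = (x i - a) * poly r (x i) + poly q a"
      by (subst q) (simp add: algebra_simps)
    then have "\<bar>x i - a\<bar> * \<bar>poly r (x i)\<bar> = \<bar>poly q (x i) - poly q a\<bar>"
      by (simp add: abs_mult)
    also have "\<dots> \<le> 2 * B"
      using Suc.prems(5)[of i] that B by linarith
    finally have "\<delta> * \<bar>poly r (x i)\<bar> \<le> 2 * B"
      using mult_right_mono[OF sep, of "\<bar>poly r (x i)\<bar>"] by linarith
    then show ?thesis using \<open>\<delta> > 0\<close> by (simp add: field_simps)
  qed
  have "degree r \<le> d" using Suc.prems(1) by (simp add: r_def degree_synthetic_div)
  then have IH: "\<bar>coeff r k\<bar> \<le> (1 + 4 / \<delta>) ^ d * (2 * B / \<delta>)" (is "_ \<le> ?R") for k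
    using Suc.prems(3,4) r_at \<open>\<delta> > 0\<close> by (intro Suc.IH) auto
  have R: "0 \<le> ?R" using IH[of 0] by linarith
  have ar: "\<bar>a * coeff r k\<bar> \<le> ?R" for k
    using mult_mono[OF a IH[of k]] by (simp add: abs_mult)
  have "\<bar>coeff q k\<bar> \<le> 2 * ?R + B"
  proof (cases k)
    case 0
    have "coeff q k = - a * coeff r 0 + poly q a"
      by (subst q) (simp add: 0)
    then show ?thesis using ar[of 0] B R by linarith
  next
    case (Suc m)
    have "coeff q k = coeff r m - a * coeff r k"
      by (subst q) (simp add: Suc)
    then show ?thesis using ar[of k] IH[of m] B by linarith
  qed
  also have "\<dots> \<le> 2 * ?R + (1 + 4 / \<delta>) ^ d * B"
    using B \<open>\<delta> > 0\<close> mult_right_mono[OF one_le_power[of "1 + 4 / \<delta>" d]] by simp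
  also have "\<dots> = (1 + 4 / \<delta>) ^ Suc d * B"
    using \<open>\<delta> > 0\<close> by (simp add: field_simps)
  finally show ?case .
qed

section \<open>Homogeneous parts and level weights of bounded set functions\<close>

lemma sum_Pow_insert:
  fixes f :: "'v set \<Rightarrow> real"
  assumes "finite Y" "u \<notin> Y"
  shows "(\<Sum>S\<in>Pow (insert u Y). f S) = (\<Sum>S\<in>Pow Y. f S + f (insert u S))"
proof -
  have "inj_on (insert u) (Pow Y)" using assms by (auto simp: inj_on_def)
  moreover have "(\<Sum>S\<in>Pow (insert u Y). f S) =
      (\<Sum>S\<in>Pow Y. f S) + (\<Sum>S\<in>insert u ` Pow Y. f S)"
    unfolding Pow_insert using assms by (intro sum.union_disjoint) auto
  ultimately show ?thesis by (simp add: sum.reindex sum.distrib)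
qed

text \<open>The weighted sum is the mean of the set function over a random subset of \<open>Y\<close> that keeps
  each element with probability \<open>t\<close>.\<close>

lemma abs_noisy_sum_le:
  fixes c :: "'v set \<Rightarrow> real"
  assumes "finite Y" "0 \<le> t" "t \<le> 1"
    and "\<And>Z. Z \<subseteq> Y \<Longrightarrow> \<bar>\<Sum>S\<in>Pow Z. c S\<bar> \<le> B"
  shows "\<bar>\<Sum>S\<in>Pow Y. c S * t ^ card S\<bar> \<le> B"
  using assms(1,4)
proof (induction Y arbitrary: c rule: finite_induct)
  case empty
  then show ?case by simp
next
  case (insert u Y)
  \<comment> \<open>\<open>c'\<close> averages over whether \<open>u\<close> is kept: its sum over
    \<open>Pow Z\<close> is a convex combination of the sums of \<open>c\<close> over
    \<open>Pow Z\<close> and \<open>Pow (insert u Z)\<close>, so the bound \<open>B\<close>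
    survives.\<close>
  define c' where "c' S = c S + t * c (insert u S)" for S
  have "(\<Sum>S\<in>Pow (insert u Y). c S * t ^ card S) = (\<Sum>S\<in>Pow Y. c' S * t ^ card S)"
    unfolding sum_Pow_insert[OF insert.hyps(1,2)]
  proof (intro sum.cong refl)
    fix S assume "S \<in> Pow Y"
    then have "finite S" "u \<notin> S" using insert.hyps by (auto intro: finite_subset)
    then show "c S * t ^ card S + c (insert u S) * t ^ card (insert u S) = c' S * t ^ card S"
      by (simp add: c'_def algebra_simps)
  qed
  moreover have "\<bar>\<Sum>S\<in>Pow Z. c' S\<bar> \<le> B" if "Z \<subseteq> Y" for Z
  proof -
    have Z: "finite Z" "u \<notin> Z" using that insert.hyps by (auto intro: finite_subset)
    let ?a = "\<Sum>S\<in>Pow Z. c S" and ?b = "\<Sum>S\<in>Pow (insert u Z). c S"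
    have "(\<Sum>S\<in>Pow Z. c' S) = (1 - t) * ?a + t * ?b"
      unfolding sum_Pow_insert[OF Z]
      by (simp add: c'_def sum.distrib sum_distrib_left[symmetric] algebra_simps)
    also have "\<bar>\<dots>\<bar> \<le> \<bar>(1 - t) * ?a\<bar> + \<bar>t * ?b\<bar>" by (rule abs_triangle_ineq)
    also have "\<dots> \<le> (1 - t) * B + t * B"
    proof (rule add_mono)
      show "\<bar>(1 - t) * ?a\<bar> \<le> (1 - t) * B"
        using insert.prems[of Z] that assms(3) by (auto simp: abs_mult intro!: mult_left_mono)
      show "\<bar>t * ?b\<bar> \<le> t * B"
        using insert.prems[of "insert u Z"] that assms(2)
        by (auto simp: abs_mult intro!: mult_left_mono)
    qed
    finally show ?thesis by (simp add: algebra_simps)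
  qed
  ultimately show ?case using insert.IH[of c'] by simp
qed

text \<open>The mean at keeping probability \<open>t\<close> is a polynomial \<open>q\<close> in
  \<open>t\<close> of degree at most \<open>d\<close> whose coefficients are the homogeneous parts.
  It is bounded by \<open>B\<close> on [0, 1], in particular at the points \<open>i / d\<close>,
  whose spacing is \<open>1 / d\<close>.\<close>

lemma abs_homogeneous_part_le:
  fixes c :: "'v set \<Rightarrow> real"
  assumes "finite Y" "0 < d"
    and deg: "\<And>S. S \<subseteq> Y \<Longrightarrow> d < card S \<Longrightarrow> c S = 0"
    and bound: "\<And>Z. Z \<subseteq> Y \<Longrightarrow> \<bar>\<Sum>S\<in>Pow Z. c S\<bar> \<le> B"
  shows "\<bar>\<Sum>S | S \<subseteq> Y \<and> card S = k. c S\<bar> \<le> (1 + 4 * real d) ^ d * B"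
proof -
  define q where "q = (\<Sum>S\<in>Pow Y. monom (c S) (card S))"
  have "coeff q k = (\<Sum>S\<in>Pow Y. if card S = k then c S else 0)"
    by (simp add: q_def coeff_sum)
  also have "\<dots> = (\<Sum>S | S \<subseteq> Y \<and> card S = k. c S)"
    using assms(1) by (subst sum.inter_filter[symmetric]) (auto intro: sum.cong)
  finally have coeff: "coeff q k = \<dots>" .
  have "degree q \<le> d"
    unfolding q_def
  proof (rule degree_sum_le)
    fix S assume "S \<in> Pow Y"
    then show "degree (monom (c S) (card S)) \<le> d"
      using deg[of S] degree_monom_le[of "c S" "card S"] by (cases "d < card S") auto
  qed (use assms(1) in simp)
  moreover have "\<bar>poly q (real i / real d)\<bar> \<le> B" if "i \<le> d" for i
    using abs_noisy_sum_le[OF assms(1) _ _ bound, of "real i / real d"] that assms(2)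
    by (simp add: q_def poly_sum poly_monom)
  moreover have "1 / real d \<le> \<bar>real i / real d - real j / real d\<bar>" if "i < j" for i j
    using that assms(2) by (simp add: diff_divide_distrib[symmetric] field_simps abs_if)
  ultimately have "\<bar>coeff q k\<bar> \<le> (1 + 4 / (1 / real d)) ^ d * B"
    using assms(2) by (intro abs_coeff_le_of_separated_points[where x = "\<lambda>i. real i / real d"]) auto
  then show ?thesis by (simp add: coeff)
qed

text \<open>Up to the factor \<open>4 ^ k\<close>, the left-hand side is the level-\<open>k\<close> Fourier weight of
  the set function, whose Fourier coefficients of top level \<open>k\<close> are \<open>c S / (-2) ^ k\<close>.\<close>

lemma level_weight_le:
  fixes c :: "'v set \<Rightarrow> real"
  assumes "finite A" "\<And>S. S \<subseteq> A \<Longrightarrow> k < card S \<Longrightarrow> c S = 0"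
  shows "2 ^ card A * (\<Sum>S | S \<subseteq> A \<and> card S = k. (c S)\<^sup>2) \<le> 4 ^ k * (\<Sum>Y\<in>Pow A. (\<Sum>S\<in>Pow Y. c S)\<^sup>2)"
  using assms
proof (induction A arbitrary: c k rule: finite_induct)
  case empty
  have "{S :: 'v set. S = {} \<and> card S = k} = (if k = 0 then {{}} else {})" by auto
  then show ?case by simp
next
  case (insert u A)
  \<comment> \<open>\<open>c1\<close> describes the difference of the values with and without
    \<open>u\<close>, and \<open>cm\<close> their average.\<close>
  define c1 where "c1 S = c (insert u S)" for S
  define cm where "cm S = c S + c1 S / 2" for S
  let ?w = "\<lambda>c k. \<Sum>S | S \<subseteq> A \<and> card S = k. (c S)\<^sup>2"
  let ?F = "\<lambda>c Y. \<Sum>S\<in>Pow Y. c S"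
  have fin: "finite {S. S \<subseteq> A \<and> card S = j}" for j
    using insert.hyps by (auto intro: finite_subset[of _ "Pow A"])
  have u: "u \<notin> S" "finite S" "card (insert u S) = Suc (card S)" if "S \<subseteq> A" for S
  proof -
    show "u \<notin> S" "finite S" using that insert.hyps by (auto intro: finite_subset)
    then show "card (insert u S) = Suc (card S)" by simp
  qed
  \<comment> \<open>Average and difference decouple by the parallelogram identity
    \<open>a^2 + (a + b)^2 = 2 * (a + b / 2)^2 + b^2 / 2\<close>.\<close>
  have split: "(\<Sum>Y\<in>Pow (insert u A). (?F c Y)\<^sup>2) =
      (\<Sum>Y\<in>Pow A. 2 * (?F cm Y)\<^sup>2 + (?F c1 Y)\<^sup>2 / 2)"
    unfolding sum_Pow_insert[OF insert.hyps(1,2)]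
  proof (intro sum.cong refl)
    fix Y assume "Y \<in> Pow A"
    then have Y: "finite Y" "u \<notin> Y" using u[of Y] by auto
    have 1: "?F c (insert u Y) = ?F c Y + ?F c1 Y"
      unfolding sum_Pow_insert[OF Y] by (simp add: c1_def sum.distrib)
    have 2: "?F cm Y = ?F c Y + ?F c1 Y / 2"
      by (simp add: cm_def sum.distrib sum_divide_distrib)
    show "(?F c Y)\<^sup>2 + (?F c (insert u Y))\<^sup>2 = 2 * (?F cm Y)\<^sup>2 + (?F c1 Y)\<^sup>2 / 2"
      unfolding 1 2 by (simp add: power2_eq_square field_simps)
  qed
  have c1_0: "c1 S = 0" if "S \<subseteq> A" "k \<le> card S" for S
    unfolding c1_def using that u[OF that(1)] by (intro insert.prems) auto
  \<comment> \<open>Level \<open>k\<close> is the top level of \<open>c\<close>, so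
    \<open>c1\<close> lives strictly below it and averaging leaves the weight at level
    \<open>k\<close> unchanged.\<close>
  have cm_w: "?w cm k = ?w c k"
    by (intro sum.cong) (auto simp: cm_def c1_0)
  have "2 ^ card A * ?w cm k \<le> 4 ^ k * (\<Sum>Y\<in>Pow A. (?F cm Y)\<^sup>2)"
  proof (rule insert.IH)
    fix S assume "S \<subseteq> A" "k < card S"
    then show "cm S = 0" using c1_0[of S] insert.prems[of S] by (auto simp: cm_def)
  qed
  then have A: "2 ^ card A * ?w c k \<le> 4 ^ k * (\<Sum>Y\<in>Pow A. (?F cm Y)\<^sup>2)"
    by (simp only: cm_w)
  have level: "{S. S \<subseteq> insert u A \<and> card S = k} =
      {S. S \<subseteq> A \<and> card S = k} \<union> insert u ` {S. S \<subseteq> A \<and> Suc (card S) = k}"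
  proof (intro equalityI subsetI)
    fix S assume S: "S \<in> {S. S \<subseteq> insert u A \<and> card S = k}"
    show "S \<in> {S. S \<subseteq> A \<and> card S = k} \<union> insert u ` {S. S \<subseteq> A \<and> Suc (card S) = k}"
    proof (cases "u \<in> S")
      case True
      then have "S = insert u (S - {u})" "S - {u} \<subseteq> A" using S by auto
      then show ?thesis using S u(3)[of "S - {u}"] by (intro UnI2 image_eqI[of _ _ "S - {u}"]) auto
    qed (use S in auto)
  qed (use u in auto)
  have "(\<Sum>S | S \<subseteq> insert u A \<and> card S = k. (c S)\<^sup>2) =
      ?w c k + (\<Sum>S \<in> insert u ` {S. S \<subseteq> A \<and> Suc (card S) = k}. (c S)\<^sup>2)"
    unfolding level using insert.hyps
    by (intro sum.union_disjoint) (auto intro: finite_subset[of _ "Pow A"])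
  also have "(\<Sum>S \<in> insert u ` {S. S \<subseteq> A \<and> Suc (card S) = k}. (c S)\<^sup>2) =
      (\<Sum>S | S \<subseteq> A \<and> Suc (card S) = k. (c1 S)\<^sup>2)"
  proof (subst sum.reindex)
    show "inj_on (insert u) {S. S \<subseteq> A \<and> Suc (card S) = k}"
      using u(1) by (intro inj_onI) (metis insert_ident mem_Collect_eq)
  qed (simp add: c1_def)
  finally have w: "(\<Sum>S | S \<subseteq> insert u A \<and> card S = k. (c S)\<^sup>2) =
      ?w c k + (\<Sum>S | S \<subseteq> A \<and> Suc (card S) = k. (c1 S)\<^sup>2)" .
  \<comment> \<open>Sets of size \<open>k\<close> containing \<open>u\<close> are sets of size
    \<open>k - 1\<close> for \<open>c1\<close>, which gains the factor 1/4. Writing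
    \<open>Suc (card S) = k\<close> makes the sum empty when \<open>k = 0\<close>.\<close>
  have B: "2 ^ card A * (\<Sum>S | S \<subseteq> A \<and> Suc (card S) = k. (c1 S)\<^sup>2) \<le>
      4 ^ k * (\<Sum>Y\<in>Pow A. (?F c1 Y)\<^sup>2) / 4"
  proof (cases k)
    case 0
    then show ?thesis by (simp add: sum_nonneg)
  next
    case (Suc j)
    have "2 ^ card A * ?w c1 j \<le> 4 ^ j * (\<Sum>Y\<in>Pow A. (?F c1 Y)\<^sup>2)"
      by (rule insert.IH) (use c1_0 Suc in auto)
    then show ?thesis by (simp add: Suc)
  qed
  have "(\<Sum>Y\<in>Pow (insert u A). (?F c Y)\<^sup>2) =
      2 * (\<Sum>Y\<in>Pow A. (?F cm Y)\<^sup>2) + (\<Sum>Y\<in>Pow A. (?F c1 Y)\<^sup>2) / 2"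
    unfolding split by (simp add: sum.distrib sum_distrib_left sum_divide_distrib)
  then show ?case
    using A B insert.hyps by (simp add: w algebra_simps)
qed

text \<open>The weight inequality is applied to the level-\<open>k\<close> part alone, each value of
  which is a bounded homogeneous part. The factor \<open>2 ^ card A\<close> cancels, so the bound
  does not depend on the number of variables, which is exponential in the application.\<close>

lemma sum_level_squares_le:
  fixes c :: "'v set \<Rightarrow> real"
  assumes "finite A" "0 < d"
    and "\<And>S. S \<subseteq> A \<Longrightarrow> d < card S \<Longrightarrow> c S = 0"
    and "\<And>Z. Z \<subseteq> A \<Longrightarrow> \<bar>\<Sum>S\<in>Pow Z. c S\<bar> \<le> B"
  shows "(\<Sum>S | S \<subseteq> A \<and> card S = k. (c S)\<^sup>2) \<le> 4 ^ k * ((1 + 4 * real d) ^ d * B)\<^sup>2"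
proof -
  define ck where "ck S = (if card S = k then c S else 0)" for S
  have bound: "(\<Sum>S\<in>Pow Y. ck S)\<^sup>2 \<le> ((1 + 4 * real d) ^ d * B)\<^sup>2" if "Y \<subseteq> A" for Y
  proof -
    have "finite Y" using that assms(1) by (rule finite_subset)
    then have "(\<Sum>S\<in>Pow Y. ck S) = (\<Sum>S | S \<subseteq> Y \<and> card S = k. c S)"
      unfolding ck_def by (subst sum.inter_filter[symmetric]) (auto intro: sum.cong)
    moreover have "\<bar>\<dots>\<bar> \<le> (1 + 4 * real d) ^ d * B"
      using that assms \<open>finite Y\<close> by (intro abs_homogeneous_part_le) auto
    ultimately show ?thesis using abs_le_square_iff by fastforce
  qed
  have "2 ^ card A * (\<Sum>S | S \<subseteq> A \<and> card S = k. (ck S)\<^sup>2) \<le>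
      4 ^ k * (\<Sum>Y\<in>Pow A. (\<Sum>S\<in>Pow Y. ck S)\<^sup>2)"
    using assms(1) by (rule level_weight_le) (simp add: ck_def)
  also have "\<dots> \<le> 4 ^ k * (\<Sum>Y\<in>Pow A. ((1 + 4 * real d) ^ d * B)\<^sup>2)"
    using bound by (intro mult_left_mono sum_mono) auto
  also have "\<dots> = 2 ^ card A * (4 ^ k * ((1 + 4 * real d) ^ d * B)\<^sup>2)"
    using assms(1) by (simp add: card_Pow)
  finally have "(\<Sum>S | S \<subseteq> A \<and> card S = k. (ck S)\<^sup>2) \<le> 4 ^ k * ((1 + 4 * real d) ^ d * B)\<^sup>2"
    by simp
  then show ?thesis by (simp add: ck_def)
qed

section \<open>From polynomials on the cube to set functions\<close>

text \<open>On Boolean points positive exponents act like 1, so all monomials with the same set of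
  variables merge into one coefficient, and a monomial counts exactly when all its variables are
  true.\<close>

lemma bool_eval_subset_sum:
  fixes p :: "'v rpoly"
  assumes "rpoly_vars p \<subseteq> A" "finite A"
  obtains c where "\<And>S. rpoly_degree p < card S \<Longrightarrow> c S = 0"
    and "\<And>y. bool_eval p y = (\<Sum>S\<in>Pow {v\<in>A. y v}. c S)"
proof -
  define c where "c S = (\<Sum>m | m \<in> Poly_Mapping.keys p \<and> Poly_Mapping.keys m = S.
    Poly_Mapping.lookup p m)" for S
  show thesis
  proof (rule that[of c])
    fix S :: "'v set" assume S: "rpoly_degree p < card S"
    have "Poly_Mapping.keys m \<noteq> S" if m: "m \<in> Poly_Mapping.keys p" for m
    proof
      assume "Poly_Mapping.keys m = S"
      then have "card S = (\<Sum>v\<in>Poly_Mapping.keys m. 1)" by simp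
      also have "\<dots> \<le> (\<Sum>v\<in>Poly_Mapping.keys m. Poly_Mapping.lookup m v)"
        by (intro sum_mono) (simp add: in_keys_iff Suc_leI)
      also have "\<dots> \<le> rpoly_degree p"
        unfolding rpoly_degree_def using m by (intro Max_ge) auto
      finally show False using S by simp
    qed
    then have "{m. m \<in> Poly_Mapping.keys p \<and> Poly_Mapping.keys m = S} = {}" by blast
    then show "c S = 0" unfolding c_def by (simp only: sum.empty)
  next
    fix y :: "'v \<Rightarrow> bool"
    define Y where "Y = {v\<in>A. y v}"
    have "finite Y" using assms(2) by (simp add: Y_def)
    let ?K = "{m \<in> Poly_Mapping.keys p. Poly_Mapping.keys m \<subseteq> Y}"
    have "bool_eval p y = (\<Sum>m\<in>Poly_Mapping.keys p.
        if Poly_Mapping.keys m \<subseteq> Y then Poly_Mapping.lookup p m else 0)"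
      unfolding bool_eval_def rpoly_eval_def
    proof (intro sum.cong refl)
      fix m assume "m \<in> Poly_Mapping.keys p"
      then have mA: "Poly_Mapping.keys m \<subseteq> A" using assms(1) by (auto simp: rpoly_vars_def)
      have "(\<Prod>v\<in>Poly_Mapping.keys m. of_bool (y v) ^ Poly_Mapping.lookup m v) =
          (if Poly_Mapping.keys m \<subseteq> Y then 1 else 0 :: real)"
      proof (cases "Poly_Mapping.keys m \<subseteq> Y")
        case True
        then have "(\<Prod>v\<in>Poly_Mapping.keys m. of_bool (y v) ^ Poly_Mapping.lookup m v) = (1::real)"
          by (intro prod.neutral) (auto simp: Y_def)
        then show ?thesis using True by simp
      next
        case False
        then obtain v where "v \<in> Poly_Mapping.keys m" "\<not> y v" using mA by (auto simp: Y_def)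
        then have "\<exists>v\<in>Poly_Mapping.keys m. of_bool (y v) ^ Poly_Mapping.lookup m v = (0::real)"
          by (auto simp: in_keys_iff)
        then show ?thesis using False by (simp add: prod_zero)
      qed
      then show "Poly_Mapping.lookup p m *
          (\<Prod>v\<in>Poly_Mapping.keys m. of_bool (y v) ^ Poly_Mapping.lookup m v) =
          (if Poly_Mapping.keys m \<subseteq> Y then Poly_Mapping.lookup p m else 0)"
        by simp
    qed
    also have "\<dots> = (\<Sum>m\<in>?K. Poly_Mapping.lookup p m)"
      by (rule sum.inter_filter[symmetric]) simp
    also have "\<dots> = (\<Sum>S\<in>Pow Y. \<Sum>m\<in>{m\<in>?K. Poly_Mapping.keys m = S}. Poly_Mapping.lookup p m)"
      using \<open>finite Y\<close> by (intro sum.group[symmetric]) auto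
    also have "\<dots> = (\<Sum>S\<in>Pow Y. c S)"
      unfolding c_def by (intro sum.cong) auto
    finally show "bool_eval p y = (\<Sum>S\<in>Pow {v\<in>A. y v}. c S)" by (simp add: Y_def)
  qed
qed

section \<open>Windows and the true coordinates of an encoding\<close>

text \<open>A window is a coordinate of \<open>ahs_index n\<close> with its string replaced by its
  length. Only quadratically many remain, which keeps the later count of window sets small.\<close>

definition windows :: "nat \<Rightarrow> (nat \<times> nat) set" where
  "windows n = {(i, l). i \<in> {1..n} \<and> l \<le> n - i + 1}"

definition covered :: "(nat \<times> nat) set \<Rightarrow> nat set" where
  "covered T = (\<Union>(i, l)\<in>T. {i..<i + l})"

definition read_window :: "(nat \<Rightarrow> bool) \<Rightarrow> nat \<times> nat \<Rightarrow> nat \<times> bool list" where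
  "read_window x = (\<lambda>(i, l). (i, map x [i..<i + l]))"

lemma finite_windows: "finite (windows n)"
  and card_windows_le: "card (windows n) \<le> n * (n + 1)"
proof -
  have sub: "windows n \<subseteq> {1..n} \<times> {..n}" by (auto simp: windows_def)
  then show "finite (windows n)" by (rule finite_subset) simp
  show "card (windows n) \<le> n * (n + 1)"
    using card_mono[OF _ sub] by simp
qed

lemma inj_read_window: "inj (read_window x)"
proof (rule injI)
  fix v w assume "read_window x v = read_window x w"
  then have "fst v = fst w \<and> length (snd (read_window x v)) = length (snd (read_window x w))"
    by (auto simp: read_window_def split: prod.splits)
  then show "v = w" by (auto simp: read_window_def prod_eq_iff split: prod.splits)
qed

lemma phi_iff: "phi i s x \<longleftrightarrow> s = map x [i..<i + length s]"
proof
  assume "phi i s x"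
  then have "x (i + k) = s ! k" if "k < length s" for k
    using that unfolding phi_def by (auto dest!: bspec[of _ _ "Suc k"])
  then show "s = map x [i..<i + length s]" by (intro nth_equalityI) auto
next
  assume s: "s = map x [i..<i + length s]"
  have "x (i + k) = s ! k" if "k < length s" for k
    using that by (subst s) simp
  then show "phi i s x"
    unfolding phi_def by (metis (no_types, lifting) Nat.add_diff_assoc Suc_le_lessD Suc_pred'
        atLeastAtMost_iff less_le_trans zero_less_one)
qed

text \<open>Each window has exactly one string that matches \<open>x\<close>. Hence sums over sets
  of true coordinates can be reindexed by sets of windows, independently of
  \<open>x\<close>.\<close>

lemma ahs_encode_true: "{v \<in> ahs_index n. ahs_encode n x v} = read_window x ` windows n"
proof (intro equalityI subsetI)
  fix v assume "v \<in> {v \<in> ahs_index n. ahs_encode n x v}"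
  then obtain i s where v: "v = (i, s)" "(i, s) \<in> ahs_index n" "phi i s x"
    by (cases v) (auto simp: ahs_encode_def)
  then have "v = read_window x (i, length s)" by (simp add: read_window_def phi_iff[symmetric])
  moreover have "(i, length s) \<in> windows n" using v(2) by (auto simp: windows_def ahs_index_def)
  ultimately show "v \<in> read_window x ` windows n" by blast
qed (auto simp: read_window_def windows_def ahs_index_def ahs_encode_def phi_iff)

section \<open>Cancellation and injectivity for sets of windows\<close>

text \<open>The negative of the usual character \<open>(-1) ^ (x_1 + ... + x_n)\<close>, so that
  approximations to parity correlate positively with it.\<close>

definition parity_sign :: "nat \<Rightarrow> (nat \<Rightarrow> bool) \<Rightarrow> real" where
  "parity_sign n x = (if parity n x then 1 else - 1)"

lemma parity_sign_flip:
  assumes "j \<in> {1..n}"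
  shows "parity_sign n (x(j := \<not> x j)) = - parity_sign n x"
proof -
  let ?O = "{i \<in> {1..n}. i \<noteq> j \<and> x i}"
  have "{i \<in> {1..n}. x i} = (if x j then insert j ?O else ?O)"
    "{i \<in> {1..n}. (x(j := \<not> x j)) i} = (if x j then ?O else insert j ?O)"
    using assms by auto
  then have "parity n (x(j := \<not> x j)) \<longleftrightarrow> \<not> parity n x"
    unfolding parity_def by (cases "x j") simp_all
  then show ?thesis by (simp add: parity_sign_def)
qed

lemma finite_cube: "finite A \<Longrightarrow> finite (cube A)"
  and card_cube: "finite A \<Longrightarrow> card (cube A) = 2 ^ card A"
  by (auto simp: cube_def card_PiE intro: finite_PiE)

text \<open>Flipping bit \<open>j\<close> is an involution of the cube that negates the sign and
  preserves \<open>g\<close>, so the sum equals its own negative.\<close>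

lemma sum_parity_sign_eq_0:
  assumes "j \<in> {1..n}" "\<And>x. x \<in> cube {1..n} \<Longrightarrow> g (x(j := \<not> x j)) = g x"
  shows "(\<Sum>x\<in>cube {1..n}. parity_sign n x * g x) = 0"
proof -
  let ?f = "\<lambda>x. x(j := \<not> x j)"
  have "?f x \<in> cube {1..n}" if "x \<in> cube {1..n}" for x
    using that assms(1) by (auto simp: cube_def PiE_def extensional_def)
  then have "(\<Sum>x\<in>cube {1..n}. parity_sign n x * g x) =
      (\<Sum>x\<in>cube {1..n}. parity_sign n (?f x) * g (?f x))"
    by (intro sum.reindex_bij_witness[of _ ?f ?f]) auto
  also have "\<dots> = - (\<Sum>x\<in>cube {1..n}. parity_sign n x * g x)"
    unfolding sum_negf[symmetric]
    by (intro sum.cong) (simp_all add: parity_sign_flip[OF assms(1)] assms(2))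
  finally show ?thesis by simp
qed

lemma read_window_cong:
  assumes "\<And>j. j \<in> covered T \<Longrightarrow> x j = x' j"
  shows "read_window x ` T = read_window x' ` T"
proof (rule image_cong[OF refl])
  fix w assume "w \<in> T"
  then show "read_window x w = read_window x' w"
    using assms by (cases w) (auto simp: read_window_def covered_def)
qed

text \<open>Covering windows spell out every bit of \<open>x\<close>. Equal starting points cause no
  confusion, since the length of the string identifies the window.\<close>

lemma inj_on_read_covering:
  assumes "{1..n} \<subseteq> covered T"
  shows "inj_on (\<lambda>x. read_window x ` T) (cube {1..n})"
proof (rule inj_onI)
  fix x x' assume x: "x \<in> cube {1..n}" "x' \<in> cube {1..n}"
    and eq: "read_window x ` T = read_window x' ` T"
  show "x = x'"
  proof (rule PiE_ext)
    show "x \<in> {1..n} \<rightarrow>\<^sub>E UNIV" "x' \<in> {1..n} \<rightarrow>\<^sub>E UNIV"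
      using x by (simp_all add: cube_def)
    fix j assume "j \<in> {1..n}"
    then obtain i l where il: "(i, l) \<in> T" "j \<in> {i..<i + l}"
      using assms by (auto simp: covered_def)
    then have "(i, map x [i..<i + l]) \<in> read_window x' ` T"
      unfolding eq[symmetric] by (force simp: read_window_def)
    then obtain l' where l': "map x [i..<i + l] = map x' [i..<i + l']"
      by (auto simp: read_window_def)
    then have "l = l'" using map_eq_imp_length_eq[OF l'] by simp
    then show "x j = x' j" using l' il(2) by auto
  qed
qed

section \<open>Correlation of a bounded low-degree set function with parity\<close>

lemma sum_abs_le_sqrt_card:
  fixes f :: "'b \<Rightarrow> real"
  assumes "finite X" "(\<Sum>x\<in>X. (f x)\<^sup>2) \<le> M\<^sup>2" "0 \<le> M"
  shows "(\<Sum>x\<in>X. \<bar>f x\<bar>) \<le> sqrt (card X) * M"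
proof -
  have "(\<Sum>x\<in>X. \<bar>f x\<bar>)\<^sup>2 \<le> (\<Sum>x\<in>X. \<bar>f x\<bar>\<^sup>2) * real (card X)"
    by (rule sum_squared_le_sum_of_squares)
  also have "\<dots> \<le> M\<^sup>2 * real (card X)"
    using assms(2) by (intro mult_right_mono) auto
  also have "\<dots> = (sqrt (card X) * M)\<^sup>2" by (simp add: power_mult_distrib)
  finally show ?thesis using assms(3) by (auto intro: power2_le_imp_le)
qed

text \<open>After exchanging sums, each window set \<open>T\<close> contributes \<open>h T\<close>,
  which is 0 unless \<open>T\<close> covers all positions and is otherwise of order
  \<open>sqrt (2 ^ n)\<close> instead of the trivial \<open>2 ^ n\<close>. The other factors count
  the sizes \<open>k\<close> of \<open>T\<close> and the sets of each size, with
  \<open>2 ^ k\<close> coming from the level bound.\<close>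

lemma parity_correlation_le:
  fixes c :: "(nat \<times> bool list) set \<Rightarrow> real"
  assumes "0 < n" "0 < d"
    and deg: "\<And>S. d < card S \<Longrightarrow> c S = 0"
    and bound: "\<And>Z. Z \<subseteq> ahs_index n \<Longrightarrow> \<bar>\<Sum>S\<in>Pow Z. c S\<bar> \<le> B"
  shows "(\<Sum>x\<in>cube {1..n}. parity_sign n x * (\<Sum>S\<in>Pow (read_window x ` windows n). c S)) \<le>
    real d * (2 * real (n * (n + 1))) ^ d * (sqrt (2 ^ n) * ((1 + 4 * real d) ^ d * B))"
proof -
  let ?X = "cube {1..n}"
  let ?M = "(1 + 4 * real d) ^ d * B"
  have B: "0 \<le> B" using bound[of "{}"] by auto
  have four: "4 ^ k = (2 ^ k :: real)\<^sup>2" for k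
    by (simp add: power2_eq_square flip: power_mult_distrib)
  define h where "h T = (\<Sum>x\<in>?X. parity_sign n x * c (read_window x ` T))" for T
  have card_read: "card (read_window x ` T) = card T" for x T
    by (rule card_image) (rule inj_on_subset[OF inj_read_window subset_UNIV])
  have h_cover: "h T \<le> sqrt (2 ^ n) * (2 ^ card T * ?M)"
    if T: "T \<subseteq> windows n" "{1..n} \<subseteq> covered T" for T
  proof -
    let ?f = "\<lambda>x. read_window x ` T"
    have "?f ` ?X \<subseteq> {S. S \<subseteq> ahs_index n \<and> card S = card T}"
      using T(1) card_read by (auto simp: read_window_def windows_def ahs_index_def)
    \<comment> \<open>By injectivity, the squares summed over all \<open>x\<close> form part of a
      single level sum.\<close>
    then have "(\<Sum>S\<in>?f ` ?X. (c S)\<^sup>2) \<le> (\<Sum>S | S \<subseteq> ahs_index n \<and> card S = card T. (c S)\<^sup>2)"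
      using finite_ahs_index[of n]
      by (intro sum_mono2) (auto intro: finite_subset[of _ "Pow (ahs_index n)"])
    also have "\<dots> \<le> 4 ^ card T * ?M\<^sup>2"
      using assms finite_ahs_index by (intro sum_level_squares_le) auto
    also have "\<dots> = (2 ^ card T * ?M)\<^sup>2"
      by (simp only: four power_mult_distrib)
    finally have sq: "(\<Sum>x\<in>?X. (c (?f x))\<^sup>2) \<le> (2 ^ card T * ?M)\<^sup>2"
      using inj_on_read_covering[OF T(2)] by (simp add: sum.reindex)
    have "h T \<le> (\<Sum>x\<in>?X. \<bar>c (?f x)\<bar>)"
      unfolding h_def by (intro sum_mono) (auto simp: parity_sign_def)
    also have "\<dots> \<le> sqrt (card ?X) * (2 ^ card T * ?M)"
      using sq B by (intro sum_abs_le_sqrt_card finite_cube) auto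
    finally show ?thesis by (simp add: card_cube)
  qed
  have h_uncover: "h T = 0" if T: "\<not> {1..n} \<subseteq> covered T" for T
  proof -
    obtain j where j: "j \<in> {1..n}" "j \<notin> covered T" using T by blast
    show ?thesis
      unfolding h_def using j
      by (intro sum_parity_sign_eq_0[of j] arg_cong[where f = c] read_window_cong) auto
  qed
  have h_le: "h T \<le> sqrt (2 ^ n) * (2 ^ card T * ?M)" if "T \<subseteq> windows n" for T
    using h_cover[OF that] h_uncover[of T] B by (cases "{1..n} \<subseteq> covered T") auto
  \<comment> \<open>The empty set covers nothing because \<open>0 < n\<close>, and sizes above
    \<open>d\<close> vanish by the degree bound; exactly \<open>d\<close> sizes remain.\<close>
  have h_0: "h T = 0" if "card T \<notin> {1..d}" "finite T" for T
  proof (cases "T = {}")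
    case True
    then show ?thesis using assms(1) by (intro h_uncover) (auto simp: covered_def)
  next
    case False
    then have "d < card T" using that by (cases "card T") auto
    then show ?thesis by (simp add: h_def deg card_read)
  qed
  have "(\<Sum>x\<in>?X. parity_sign n x * (\<Sum>S\<in>Pow (read_window x ` windows n). c S)) =
      (\<Sum>x\<in>?X. \<Sum>T\<in>Pow (windows n). parity_sign n x * c (read_window x ` T))"
  proof (intro sum.cong refl)
    fix x :: "nat \<Rightarrow> bool"
    have "inj_on (image (read_window x)) (Pow (windows n))"
      using inj_read_window by (intro inj_on_image_Pow) (auto intro: inj_on_subset)
    moreover have "Pow (read_window x ` windows n) = image (read_window x) ` Pow (windows n)"
      by (simp add: image_Pow_surj)
    ultimately show "parity_sign n x * (\<Sum>S\<in>Pow (read_window x ` windows n). c S) =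
        (\<Sum>T\<in>Pow (windows n). parity_sign n x * c (read_window x ` T))"
      by (simp add: sum.reindex sum_distrib_left)
  qed
  also have "\<dots> = (\<Sum>T\<in>Pow (windows n). h T)"
    unfolding h_def by (rule sum.swap)
  also have "\<dots> = (\<Sum>T | T \<subseteq> windows n \<and> card T \<in> {1..d}. h T)"
    using finite_windows[of n] h_0 by (intro sum.mono_neutral_right) (auto intro: finite_subset)
  also have "\<dots> = (\<Sum>k\<in>{1..d}. \<Sum>T\<in>{T \<in> {T. T \<subseteq> windows n \<and> card T \<in> {1..d}}. card T = k}. h T)"
    using finite_windows[of n]
    by (intro sum.group[symmetric]) (auto intro: finite_subset[of _ "Pow (windows n)"])
  also have "\<dots> \<le> (\<Sum>k\<in>{1..d}. (2 * real (n * (n + 1))) ^ d * (sqrt (2 ^ n) * ?M))"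
  proof (rule sum_mono)
    fix k assume k: "k \<in> {1..d}"
    have "{T \<in> {T. T \<subseteq> windows n \<and> card T \<in> {1..d}}. card T = k} =
        {T. T \<subseteq> windows n \<and> card T = k}" using k by auto
    moreover have "(\<Sum>T | T \<subseteq> windows n \<and> card T = k. h T) \<le>
        (\<Sum>T | T \<subseteq> windows n \<and> card T = k. sqrt (2 ^ n) * (2 ^ k * ?M))"
      by (rule sum_mono) (use h_le in blast)
    ultimately have "(\<Sum>T\<in>{T \<in> {T. T \<subseteq> windows n \<and> card T \<in> {1..d}}. card T = k}. h T) \<le>
        (\<Sum>T | T \<subseteq> windows n \<and> card T = k. sqrt (2 ^ n) * (2 ^ k * ?M))"
      by (simp only:)
    also have "\<dots> = real (card (windows n) choose k) * (sqrt (2 ^ n) * (2 ^ k * ?M))"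
      by (simp add: n_subsets finite_windows)
    also have "\<dots> \<le> real (n * (n + 1)) ^ k * (sqrt (2 ^ n) * (2 ^ k * ?M))"
    proof (rule mult_right_mono)
      have "card (windows n) choose k \<le> card (windows n) ^ k"
        by (cases "k \<le> card (windows n)") (simp_all add: binomial_le_pow binomial_eq_0)
      also have "\<dots> \<le> (n * (n + 1)) ^ k" by (intro power_mono card_windows_le) simp
      finally show "real (card (windows n) choose k) \<le> real (n * (n + 1)) ^ k"
        by (metis of_nat_le_iff of_nat_power)
    qed (use B in simp)
    also have "\<dots> = (2 * real (n * (n + 1))) ^ k * (sqrt (2 ^ n) * ?M)"
      by (simp only: power_mult_distrib mult_ac)
    also have "\<dots> \<le> (2 * real (n * (n + 1))) ^ d * (sqrt (2 ^ n) * ?M)"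
    proof (intro mult_right_mono power_increasing)
      have "1 \<le> n * (n + 1)" using assms(1) by simp
      then show "1 \<le> 2 * real (n * (n + 1))"
        by (smt (verit) of_nat_1 of_nat_le_iff)
    qed (use k B in auto)
    finally show "(\<Sum>T\<in>{T \<in> {T. T \<subseteq> windows n \<and> card T \<in> {1..d}}. card T = k}. h T) \<le>
      (2 * real (n * (n + 1))) ^ d * (sqrt (2 ^ n) * ?M)" .
  qed
  finally show ?thesis by simp
qed

section \<open>The lower bound on the degree\<close>

text \<open>Centred at 1/2, the approximation agrees with the parity sign by at least \<gamma> at
  every \<open>x\<close>, so the correlation is at least \<open>\<gamma> * 2 ^ n\<close>. Comparison
  with the upper bound cancels one factor \<open>sqrt (2 ^ n)\<close>.\<close>

lemma approximation_advantage_le: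
  assumes "2 \<le> n" "0 < \<gamma>" "\<gamma> < 1 / 2"
    and p: "approximates (ahs_index n) (1 / 2 - \<gamma>) p (AHS n)"
    and d: "rpoly_degree p \<le> n"
  shows "0 < rpoly_degree p \<and> \<gamma> * sqrt (2 ^ n) \<le> real n ^ (10 * rpoly_degree p)"
proof -
  let ?X = "cube {1..n}" and ?A = "ahs_index n"
  obtain c where deg: "\<And>S. rpoly_degree p < card S \<Longrightarrow> c S = 0"
    and c: "\<And>y. bool_eval p y = (\<Sum>S\<in>Pow {v\<in>?A. y v}. c S)"
    using p bool_eval_subset_sum[of p ?A] finite_ahs_index by (auto simp: approximates_def)
  \<comment> \<open>Every \<open>Z\<close> is the truth set of some point of the cube, usually not
    an encoding; here boundedness outside the domain enters.\<close>
  have bound: "\<bar>\<Sum>S\<in>Pow Z. c S\<bar> \<le> 3 / 2" if "Z \<subseteq> ?A" for Z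
  proof -
    define y where "y = restrict (\<lambda>v. v \<in> Z) ?A"
    have "y \<in> cube ?A" by (simp add: y_def cube_def)
    then have "- (1 / 2 - \<gamma>) \<le> bool_eval p y" "bool_eval p y \<le> 1 + (1 / 2 - \<gamma>)"
      using p unfolding approximates_def by blast+
    then have "\<bar>bool_eval p y\<bar> \<le> 3 / 2" using assms(2,3) by linarith
    moreover have "{v\<in>?A. y v} = Z" using that by (auto simp: y_def)
    ultimately show ?thesis by (simp add: c)
  qed
  let ?E = "\<lambda>x. bool_eval p (ahs_encode n x)"
  have adv: "\<gamma> \<le> parity_sign n x * (?E x - 1 / 2)" if "x \<in> ?X" for x
  proof -
    have "\<bar>?E x - of_bool (parity n x)\<bar> \<le> 1 / 2 - \<gamma>"
      using p AHS_encode[OF that] that unfolding approximates_def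
      by (metis dom_AHS image_eqI option.sel)
    then show ?thesis by (cases "parity n x") (simp_all add: parity_sign_def abs_le_iff)
  qed
  have zero: "(\<Sum>x\<in>?X. parity_sign n x * (1 / 2)) = 0"
    using assms(1) by (intro sum_parity_sign_eq_0[of 1]) auto
  have "\<gamma> * 2 ^ n = (\<Sum>x\<in>?X. \<gamma>)" by (simp add: card_cube)
  also have "\<dots> \<le> (\<Sum>x\<in>?X. parity_sign n x * (?E x - 1 / 2))"
    by (intro sum_mono adv)
  also have "\<dots> = (\<Sum>x\<in>?X. parity_sign n x * ?E x)"
    using zero by (simp add: right_diff_distrib sum_subtractf)
  finally have corr: "\<gamma> * 2 ^ n \<le> (\<Sum>x\<in>?X. parity_sign n x * ?E x)" .
  \<comment> \<open>A polynomial of degree 0 is constant on the cube and thus uncorrelated with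
    parity.\<close>
  have pos: "0 < rpoly_degree p"
  proof (rule ccontr)
    assume "\<not> 0 < rpoly_degree p"
    then have const: "c S = 0" if "finite S" "S \<noteq> {}" for S
      using that by (intro deg) (simp add: card_gt_0_iff)
    have "?E x = c {}" for x
    proof -
      have "(\<Sum>S\<in>Pow {v\<in>?A. ahs_encode n x v}. c S) = (\<Sum>S\<in>{{}}. c S)"
        using finite_ahs_index[of n] const
        by (intro sum.mono_neutral_right) (auto intro: finite_subset[OF _ finite_ahs_index])
      then show ?thesis by (simp add: c)
    qed
    moreover have "(\<Sum>x\<in>?X. parity_sign n x * c {}) = 0"
      using assms(1) by (intro sum_parity_sign_eq_0[of 1]) auto
    ultimately have "\<gamma> * 2 ^ n \<le> 0" using corr by simp
    then show False using assms(2) by (simp add: mult_le_0_iff flip: not_less)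
  qed
  define e where "e = rpoly_degree p"
  define r where "r = real n"
  have e: "0 < e" "real e \<le> r" and r: "2 \<le> r" using pos d assms(1) by (auto simp: e_def r_def)
  have "\<gamma> * 2 ^ n \<le> real e * (2 * real (n * (n + 1))) ^ e * (sqrt (2 ^ n) * ((1 + 4 * real e) ^ e * (3 / 2)))"
    using corr parity_correlation_le[of n "rpoly_degree p" c "3 / 2", OF _ pos deg bound] assms(1)
    by (simp add: c ahs_encode_true e_def)
  moreover have "sqrt (2 ^ n) * sqrt (2 ^ n) = (2 :: real) ^ n" by simp
  ultimately have "(\<gamma> * sqrt (2 ^ n)) * sqrt (2 ^ n) \<le>
      (real e * (2 * real (n * (n + 1))) ^ e * ((1 + 4 * real e) ^ e * (3 / 2))) * sqrt (2 ^ n)"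
    by (simp add: mult.assoc mult.left_commute mult.commute)
  then have "\<gamma> * sqrt (2 ^ n) \<le> real e * (2 * real (n * (n + 1))) ^ e * ((1 + 4 * real e) ^ e * (3 / 2))"
    by (rule mult_right_le_imp_le) simp
  \<comment> \<open>With \<open>2 \<le> r\<close> and \<open>e \<le> r\<close>, the four factors are
    absorbed into powers of \<open>r\<close>; their exponents add to
    \<open>1 + 4 + 4 + 1 = 10\<close> times \<open>e\<close>.\<close>
  also have "\<dots> \<le> r ^ e * (r ^ 4) ^ e * ((r ^ 4) ^ e * r ^ e)"
  proof (intro mult_mono power_mono)
    have r4: "8 * r \<le> r ^ 4" "4 * r\<^sup>2 \<le> r ^ 4"
    proof -
      have "2 ^ 3 * r \<le> r ^ 3 * r" using r by (intro mult_right_mono power_mono) auto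
      then show "8 * r \<le> r ^ 4" by (simp add: power3_eq_cube power4_eq_xxxx)
      have "2\<^sup>2 * r\<^sup>2 \<le> r\<^sup>2 * r\<^sup>2" using r by (intro mult_right_mono power_mono) auto
      then show "4 * r\<^sup>2 \<le> r ^ 4" by (simp add: power2_eq_square power4_eq_xxxx)
    qed
    have "e < 2 ^ e" by (rule less_exp)
    then have "real e \<le> 2 ^ e" by (metis less_imp_le of_nat_le_iff of_nat_numeral of_nat_power)
    also have "\<dots> \<le> r ^ e" using r by (intro power_mono) auto
    finally show "real e \<le> r ^ e" .
    have "r * 1 \<le> r * r" using r by (intro mult_left_mono) auto
    then show "2 * real (n * (n + 1)) \<le> r ^ 4"
      using r4(2) by (simp add: r_def[symmetric] algebra_simps power2_eq_square)
    show "1 + 4 * real e \<le> r ^ 4" using r4(1) e r by linarith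
    have "3 / 2 \<le> r" using r by simp
    also have "r = r ^ 1" by simp
    also have "\<dots> \<le> r ^ e" using r e by (intro power_increasing) auto
    finally show "3 / 2 \<le> r ^ e" .
  qed (use r in auto)
  also have "\<dots> = r ^ (10 * e)"
    by (simp flip: power_mult power_add)
  finally show ?thesis using pos by (simp add: e_def r_def)
qed

theorem theorem4p3:
  shows "\<exists>c::real. c > 0 \<and>
    (\<forall>n::nat. \<forall>\<gamma>::real. 2 \<le> n \<longrightarrow> 0 < \<gamma> \<longrightarrow> \<gamma> < 1 / 2 \<longrightarrow>
       real (approx_degree (ahs_index n) (1 / 2 - \<gamma>) (AHS n))
         \<ge> c * (real n / log 2 (real n) - log 2 (1 / \<gamma>)))"
proof (intro exI[of _ "1 / 20"] conjI allI impI)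
  fix n :: nat and \<gamma> :: real
  assume n: "2 \<le> n" and \<gamma>: "0 < \<gamma>" "\<gamma> < 1 / 2"
  define d where "d = approx_degree (ahs_index n) (1 / 2 - \<gamma>) (AHS n)"
  obtain p where p: "approximates (ahs_index n) (1 / 2 - \<gamma>) p (AHS n)" "rpoly_degree p = d"
    using approx_degree_attained[OF finite_ahs_index dom_AHS_subset, of "1 / 2 - \<gamma>" n] \<gamma>
    by (auto simp: d_def)
  define L where "L = log 2 (real n)"
  define G where "G = log 2 (1 / \<gamma>)"
  have L: "1 \<le> L" using n by (simp add: L_def)
  have G: "0 \<le> G" using \<gamma> by (simp add: G_def)
  have nL: "real n / L \<le> real n" using divide_left_mono[OF L] L by simp
  have "1 / 20 * (real n / L - G) \<le> real d"
  proof (cases "d \<le> n")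
    case False
    then show ?thesis using nL G by simp
  next
    case True
    then have d: "0 < d" "\<gamma> * sqrt (2 ^ n) \<le> real n ^ (10 * d)"
      using approximation_advantage_le[OF n \<gamma> p(1)] p(2) by auto
    have "log 2 (\<gamma> * sqrt (2 ^ n)) \<le> log 2 (real n ^ (10 * d))"
      using d(2) \<gamma> n by (subst log_le_cancel_iff) auto
    moreover have "log 2 (\<gamma> * sqrt (2 ^ n)) = real n / 2 - G"
      using \<gamma> by (simp add: G_def log_mult log_divide sqrt_def log_root log_nat_power)
    moreover have "log 2 (real n ^ (10 * d)) = 10 * real d * L"
      using n by (simp add: L_def log_nat_power)
    ultimately have main: "real n / 2 - G \<le> 10 * real d * L" by simp
    \<comment> \<open>For \<open>4 \<le> n\<close>, \<open>2 \<le> L\<close> lets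
      \<open>L * G\<close> absorb \<open>2 * G\<close>, and dividing by \<open>L\<close> gives the
      constant \<open>1 / 20\<close>. For \<open>n\<close> equal to 2 or 3,
      \<open>real n / L \<le> 3\<close> and \<open>0 < d\<close> suffice.\<close>
    show ?thesis
    proof (cases "4 \<le> n")
      case True
      have "log 2 (2\<^sup>2) \<le> L" unfolding L_def using True by (subst log_le_cancel_iff) auto
      then have L2: "2 \<le> L" by (subst (asm) log_nat_power) simp_all
      then have "2 * G \<le> L * G" using G by (intro mult_right_mono)
      then have "real n \<le> (20 * real d + G) * L" using main by (simp add: algebra_simps)
      then have "real n / L \<le> 20 * real d + G" using L by (simp add: field_simps)
      then show ?thesis by simp
    next
      case False
      then have "real n \<le> 3" by simp
      then have "real n / L \<le> 3" using nL by linarith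
      then show ?thesis using G d(1) by simp
    qed
  qed
  then show "1 / 20 * (real n / log 2 (real n) - log 2 (1 / \<gamma>)) \<le>
      real (approx_degree (ahs_index n) (1 / 2 - \<gamma>) (AHS n))"
    by (simp add: L_def G_def d_def)
qed simp

end
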